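(* Let $\mathbf M$ be an infinite $\mathcal L$-structure with the strong $\mathrm{VC}d$ property, and let $r\in\mathbb R$ be such that $\pi^*_\Delta(t)=O(t^r)$ for every finite nonempty set $\Delta(x;y)$ of partitioned $\mathcal L$-formulas with $|x|=1$. Then $\pi^*_\Delta(t)=O(t^{d(|x|-1)+r})$ for every finite nonempty set $\Delta(x;y)$ of partitioned $\mathcal L$-formulas.
   Context: For a finite set $\Delta(x;y)$ of partitioned formulas and finite $B\subseteq M^{|y|}$, $S^\Delta(B)$ is the set of $\Delta$-types $\mathrm{tp}^\Delta(a/B)=\{\varphi(x;b):\mathbf M\models\varphi(a;b)\}\cup\{\neg\varphi(x;b):\mathbf M\not\models\varphi(a;b)\}$ ($\varphi\in\Delta$, $b\in B$), $a\in M^{|x|}$, and $\pi^*_\Delta(t)=\max\{|S^\Delta(B)|:B\subseteq M^{|y|},|B|=t\}$. A uniform definition of $\Delta(x;B)$-types over finite sets with $d$ parameters is a finite family $(\mathcal F_i)_{i\in I}$, $\mathcal F_i=(\varphi_i(y;y_1,\dots,y_d))_{\varphi\in\Delta}$ ($|y_j|=|y|$), such that for every finite $B\subseteq M^{|y|}$ and $q\in S^\Delta(B)$ there exist $b_1,\dots,b_d\in B$ and $i\in I$ with $\varphi(x;b)\in q\iff\mathbf M\models\varphi_i(b;b_1,\dots,b_d)$ for all $\varphi\in\Delta,b\in B$; it is coherent if moreover for every $i$ and all $b_1,\dots,b_d\in M^{|y|}$ the set $\{\varphi(x;b):\varphi\in\Delta,b\in M^{|y|},\mathbf M\models\varphi_i(b;b_1,\dots,b_d)\}$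 is consistent with $\mathbf M$. $\mathbf M$ has the strong $\mathrm{VC}d$ property if every finite nonempty $\Delta(x;y)$ with $|x|=1$ has a coherent uniform definition of $\Delta(x;B)$-types over finite sets with $d$ parameters. *)

theory Defs
  imports Complex_Main "HOL-Library.Landau_Symbols"
begin

text \<open>Sets of symbols are explicit, so that a language may have no function symbols or
  no relation symbols (constants are function symbols of arity 0).\<close>

record ('f, 'r) language =
  funs :: "'f set"
  rels :: "'r set"
  farity :: "'f \<Rightarrow> nat"
  rarity :: "'r \<Rightarrow> nat"

datatype 'f trm = Var nat | Fn 'f "'f trm list"

datatype ('f, 'r) fm =
    Eq "'f trm" "'f trm"
  | Rel 'r "'f trm list"
  | Neg "('f, 'r) fm"
  | Conj "('f, 'r) fm" "('f, 'r) fm"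
  | Ex nat "('f, 'r) fm"

fun wf_trm :: "('f, 'r) language \<Rightarrow> 'f trm \<Rightarrow> bool" where
  "wf_trm L (Var v) \<longleftrightarrow> True"
| "wf_trm L (Fn f ts) \<longleftrightarrow>
     f \<in> funs L \<and> length ts = farity L f \<and> (\<forall>t\<in>set ts. wf_trm L t)"

fun wf_fm :: "('f, 'r) language \<Rightarrow> ('f, 'r) fm \<Rightarrow> bool" where
  "wf_fm L (Eq s t) \<longleftrightarrow> wf_trm L s \<and> wf_trm L t"
| "wf_fm L (Rel R ts) \<longleftrightarrow>
     R \<in> rels L \<and> length ts = rarity L R \<and> (\<forall>t\<in>set ts. wf_trm L t)"
| "wf_fm L (Neg p) \<longleftrightarrow> wf_fm L p"
| "wf_fm L (Conj p q) \<longleftrightarrow> wf_fm L p \<and> wf_fm L q"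
| "wf_fm L (Ex v p) \<longleftrightarrow> wf_fm L p"

fun fv_trm :: "'f trm \<Rightarrow> nat set" where
  "fv_trm (Var v) = {v}"
| "fv_trm (Fn f ts) = (\<Union>t\<in>set ts. fv_trm t)"

fun fv :: "('f, 'r) fm \<Rightarrow> nat set" where
  "fv (Eq s t) = fv_trm s \<union> fv_trm t"
| "fv (Rel R ts) = (\<Union>t\<in>set ts. fv_trm t)"
| "fv (Neg p) = fv p"
| "fv (Conj p q) = fv p \<union> fv q"
| "fv (Ex v p) = fv p - {v}"

record ('f, 'r, 'm) struct =
  univ :: "'m set"
  fint :: "'f \<Rightarrow> 'm list \<Rightarrow> 'm"
  rint :: "'r \<Rightarrow> 'm list \<Rightarrow> bool"

definition tuples :: "('f, 'r, 'm) struct \<Rightarrow> nat \<Rightarrow> 'm list set" where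
  "tuples M n = {as. length as = n \<and> set as \<subseteq> univ M}"

definition is_structure :: "('f, 'r) language \<Rightarrow> ('f, 'r, 'm) struct \<Rightarrow> bool" where
  "is_structure L M \<longleftrightarrow>
     univ M \<noteq> {} \<and> (\<forall>f\<in>funs L. \<forall>as\<in>tuples M (farity L f). fint M f as \<in> univ M)"

fun eval :: "('f, 'r, 'm) struct \<Rightarrow> (nat \<Rightarrow> 'm) \<Rightarrow> 'f trm \<Rightarrow> 'm" where
  "eval M e (Var v) = e v"
| "eval M e (Fn f ts) = fint M f (map (eval M e) ts)"

fun sat :: "('f, 'r, 'm) struct \<Rightarrow> (nat \<Rightarrow> 'm) \<Rightarrow> ('f, 'r) fm \<Rightarrow> bool" where
  "sat M e (Eq s t) \<longleftrightarrow> eval M e s = eval M e t"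
| "sat M e (Rel R ts) \<longleftrightarrow> rint M R (map (eval M e) ts)"
| "sat M e (Neg p) \<longleftrightarrow> \<not> sat M e p"
| "sat M e (Conj p q) \<longleftrightarrow> sat M e p \<and> sat M e q"
| "sat M e (Ex v p) \<longleftrightarrow> (\<exists>a\<in>univ M. sat M (e(v := a)) p)"

text \<open>A partitioned formula \<open>\<phi>(x;y)\<close> is a formula together with two disjoint tuples
  \<open>xs\<close>, \<open>ys\<close> of distinct variables that contain all its free variables.\<close>

definition partitioned ::
  "('f, 'r) language \<Rightarrow> nat list \<Rightarrow> nat list \<Rightarrow> ('f, 'r) fm \<Rightarrow> bool" where
  "partitioned L xs ys \<phi> \<longleftrightarrow>
     distinct (xs @ ys) \<and> wf_fm L \<phi> \<and> fv \<phi> \<subseteq> set xs \<union> set ys"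

text \<open>Both tuples of variables are nonempty: for \<open>|y| = 0\<close> there is no \<open>B\<close> with
  \<open>|B| = t \<ge> 2\<close>, so \<open>\<pi>\<^sup>*\<close> would be a maximum over the empty set.\<close>

definition partitioned_set ::
  "('f, 'r) language \<Rightarrow> nat list \<Rightarrow> nat list \<Rightarrow> ('f, 'r) fm set \<Rightarrow> bool" where
  "partitioned_set L xs ys \<Delta> \<longleftrightarrow>
     xs \<noteq> [] \<and> ys \<noteq> [] \<and> finite \<Delta> \<and> \<Delta> \<noteq> {} \<and> (\<forall>\<phi>\<in>\<Delta>. partitioned L xs ys \<phi>)"

text \<open>\<open>holds M xs ys \<phi> a b\<close> is \<open>M \<Turnstile> \<phi>(a;b)\<close>. Variables outside \<open>xs @ ys\<close> get an arbitrary
  value, which is irrelevant for partitioned formulas.\<close>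

definition holds ::
  "('f, 'r, 'm) struct \<Rightarrow> nat list \<Rightarrow> nat list \<Rightarrow> ('f, 'r) fm \<Rightarrow> 'm list \<Rightarrow> 'm list \<Rightarrow> bool" where
  "holds M xs ys \<phi> a b \<longleftrightarrow> sat M (\<lambda>v. the (map_of (zip (xs @ ys) (a @ b)) v)) \<phi>"

text \<open>\<open>Pos \<phi> b\<close> stands for \<open>\<phi>(x;b)\<close> and \<open>NegInst \<phi> b\<close> for \<open>\<not>\<phi>(x;b)\<close>.\<close>

datatype ('f, 'r, 'm) inst = Pos "('f, 'r) fm" "'m list" | NegInst "('f, 'r) fm" "'m list"

fun inst_holds ::
  "('f, 'r, 'm) struct \<Rightarrow> nat list \<Rightarrow> nat list \<Rightarrow> 'm list \<Rightarrow> ('f, 'r, 'm) inst \<Rightarrow> bool" where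
  "inst_holds M xs ys a (Pos \<phi> b) \<longleftrightarrow> holds M xs ys \<phi> a b"
| "inst_holds M xs ys a (NegInst \<phi> b) \<longleftrightarrow> \<not> holds M xs ys \<phi> a b"

definition tp ::
  "('f, 'r, 'm) struct \<Rightarrow> nat list \<Rightarrow> nat list \<Rightarrow> ('f, 'r) fm set \<Rightarrow> 'm list \<Rightarrow> 'm list set
   \<Rightarrow> ('f, 'r, 'm) inst set" where
  "tp M xs ys \<Delta> a B =
     {Pos \<phi> b | \<phi> b. \<phi> \<in> \<Delta> \<and> b \<in> B \<and> holds M xs ys \<phi> a b} \<union>
     {NegInst \<phi> b | \<phi> b. \<phi> \<in> \<Delta> \<and> b \<in> B \<and> \<not> holds M xs ys \<phi> a b}"

definition types ::
  "('f, 'r, 'm) struct \<Rightarrow> nat list \<Rightarrow> nat list \<Rightarrow> ('f, 'r) fm set \<Rightarrow> 'm list set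
   \<Rightarrow> ('f, 'r, 'm) inst set set" where
  "types M xs ys \<Delta> B = {tp M xs ys \<Delta> a B | a. a \<in> tuples M (length xs)}"

definition pi_star ::
  "('f, 'r, 'm) struct \<Rightarrow> nat list \<Rightarrow> nat list \<Rightarrow> ('f, 'r) fm set \<Rightarrow> nat \<Rightarrow> nat" where
  "pi_star M xs ys \<Delta> t =
     Max {card (types M xs ys \<Delta> B) | B. B \<subseteq> tuples M (length ys) \<and> finite B \<and> card B = t}"

text \<open>A set of formulas with parameters in \<open>M\<close> is consistent with \<open>M\<close> if it is finitely
  satisfiable in \<open>M\<close>, that is (compactness), consistent with the elementary diagram of \<open>M\<close>.\<close>

definition consistent_with ::
  "('f, 'r, 'm) struct \<Rightarrow> nat list \<Rightarrow> nat list \<Rightarrow> ('f, 'r, 'm) inst set \<Rightarrow> bool" where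
  "consistent_with M xs ys \<Phi> \<longleftrightarrow>
     (\<forall>\<Phi>\<^sub>0\<subseteq>\<Phi>. finite \<Phi>\<^sub>0 \<longrightarrow> (\<exists>a\<in>tuples M (length xs). \<forall>\<theta>\<in>\<Phi>\<^sub>0. inst_holds M xs ys a \<theta>))"

text \<open>\<open>zs\<close> is the list of tuples of variables \<open>y\<^sub>1, \<dots>, y\<^sub>d\<close>, \<open>F i \<phi>\<close> is the formula \<open>\<phi>\<^sub>i\<close>, and
  \<open>bs\<close> is the list \<open>b\<^sub>1, \<dots>, b\<^sub>d\<close>. The sets \<open>B\<close> are nonempty: for \<open>B = {}\<close> and \<open>d > 0\<close> there
  are no \<open>b\<^sub>1, \<dots>, b\<^sub>d \<in> B\<close>, and the notion would never apply.\<close>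

definition uniform_definition ::
  "('f, 'r) language \<Rightarrow> ('f, 'r, 'm) struct \<Rightarrow> nat list \<Rightarrow> nat list \<Rightarrow> ('f, 'r) fm set \<Rightarrow> nat
   \<Rightarrow> nat list list \<Rightarrow> nat set \<Rightarrow> (nat \<Rightarrow> ('f, 'r) fm \<Rightarrow> ('f, 'r) fm) \<Rightarrow> bool" where
  "uniform_definition L M xs ys \<Delta> d zs I F \<longleftrightarrow>
     finite I \<and> length zs = d \<and> (\<forall>z\<in>set zs. length z = length ys) \<and>
     (\<forall>i\<in>I. \<forall>\<phi>\<in>\<Delta>. partitioned L ys (concat zs) (F i \<phi>)) \<and>
     (\<forall>B. finite B \<and> B \<noteq> {} \<and> B \<subseteq> tuples M (length ys) \<longrightarrow>
        (\<forall>q\<in>types M xs ys \<Delta> B. \<exists>bs. length bs = d \<and> set bs \<subseteq> B \<and>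
           (\<exists>i\<in>I. \<forall>\<phi>\<in>\<Delta>. \<forall>b\<in>B.
              Pos \<phi> b \<in> q \<longleftrightarrow> holds M ys (concat zs) (F i \<phi>) b (concat bs))))"

definition coherent ::
  "('f, 'r, 'm) struct \<Rightarrow> nat list \<Rightarrow> nat list \<Rightarrow> ('f, 'r) fm set \<Rightarrow> nat
   \<Rightarrow> nat list list \<Rightarrow> nat set \<Rightarrow> (nat \<Rightarrow> ('f, 'r) fm \<Rightarrow> ('f, 'r) fm) \<Rightarrow> bool" where
  "coherent M xs ys \<Delta> d zs I F \<longleftrightarrow>
     (\<forall>i\<in>I. \<forall>bs. length bs = d \<and> set bs \<subseteq> tuples M (length ys) \<longrightarrow>
        consistent_with M xs ys
          {Pos \<phi> b | \<phi> b. \<phi> \<in> \<Delta> \<and> b \<in> tuples M (length ys) \<and>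
             holds M ys (concat zs) (F i \<phi>) b (concat bs)})"

definition strong_VC :: "('f, 'r) language \<Rightarrow> ('f, 'r, 'm) struct \<Rightarrow> nat \<Rightarrow> bool" where
  "strong_VC L M d \<longleftrightarrow>
     (\<forall>xs ys \<Delta>. partitioned_set L xs ys \<Delta> \<and> length xs = 1 \<longrightarrow>
        (\<exists>zs I F. uniform_definition L M xs ys \<Delta> d zs I F \<and> coherent M xs ys \<Delta> d zs I F))"

end

theory Submission
  imports Defs
begin

text \<open>Induction on \<open>|x|\<close>. Write \<open>x = (x\<^sub>0, x')\<close>. A uniform definition of the types in the single
  variable \<open>x\<^sub>0\<close>, with parameter variables \<open>(x', y)\<close>, applied to the parameter set \<open>{a'} \<times> B\<close>
  shows that \<open>tp(a\<^sub>0, a' / B)\<close> is determined by an index \<open>i\<close>, parameters \<open>b\<^sub>1, \<dots>, b\<^sub>d \<in> B\<close> and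
  the type of \<open>a'\<close> over \<open>B \<times> {(b\<^sub>1, \<dots>, b\<^sub>d)}\<close> with respect to the formulas
  \<open>\<phi>\<^sub>i(x', y; x', y\<^sub>1, \<dots>, x', y\<^sub>d)\<close>. So each further variable costs a factor \<open>O(t\<^sup>d)\<close>.\<close>

section \<open>Identifying variables of a formula\<close>

lemma eval_cong:
  "(\<And>v. v \<in> fv_trm t \<Longrightarrow> e v = e' v) \<Longrightarrow> eval M e t = eval M e' t"
proof (induction t)
  case (Fn f ts)
  have "map (eval M e) ts = map (eval M e') ts"
    using Fn by (intro map_cong refl) auto
  then show ?case by (simp del: map_eq_conv)
qed simp

lemma sat_cong:
  "(\<And>v. v \<in> fv p \<Longrightarrow> e v = e' v) \<Longrightarrow> sat M e p \<longleftrightarrow> sat M e' p"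
proof (induction p arbitrary: e e')
  case (Eq s t)
  then have "eval M e s = eval M e' s" "eval M e t = eval M e' t"
    by (auto intro!: eval_cong)
  then show ?case by simp
next
  case (Rel R ts)
  have "map (eval M e) ts = map (eval M e') ts"
    using Rel by (intro map_cong refl eval_cong) auto
  then show ?case by (simp del: map_eq_conv)
next
  case (Neg p)
  have "sat M e p \<longleftrightarrow> sat M e' p" by (rule Neg.IH) (simp add: Neg.prems)
  then show ?case by simp
next
  case (Conj p q)
  have "sat M e p \<longleftrightarrow> sat M e' p" by (rule Conj.IH) (simp add: Conj.prems)
  moreover have "sat M e q \<longleftrightarrow> sat M e' q" by (rule Conj.IH) (simp add: Conj.prems)
  ultimately show ?case by simp
next
  case (Ex v p)
  have "sat M (e(v := a)) p \<longleftrightarrow> sat M (e'(v := a)) p" for a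
    by (rule Ex.IH) (simp add: Ex.prems)
  then show ?case by simp
qed

text \<open>Expressing \<open>\<phi>(x/u)\<close> as \<open>\<exists>u. u = x \<and> \<phi>\<close> makes renaming of bound variables unnecessary.\<close>

fun identify :: "(nat \<times> nat) list \<Rightarrow> ('f, 'r) fm \<Rightarrow> ('f, 'r) fm" where
  "identify [] p = p"
| "identify ((u, x) # ps) p = Ex u (Conj (Eq (Var u) (Var x)) (identify ps p))"

lemma wf_fm_identify [simp]: "wf_fm L (identify ps p) \<longleftrightarrow> wf_fm L p"
  by (induction ps p rule: identify.induct) auto

lemma fv_identify: "fv (identify ps p) \<subseteq> (fv p - fst ` set ps) \<union> snd ` set ps"
  by (induction ps p rule: identify.induct) auto

text \<open>The quantifier over \<open>u\<close> with \<open>u = x\<close> admits only the witness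
  \<open>e x\<close>, so evaluation continues under \<open>e(u := e x)\<close>; after all pairs the
  valuation agrees with \<open>e'\<close> on \<open>fv p\<close>. Disjointness keeps the updates
  from changing values that are still to be read.\<close>

lemma sat_identify:
  assumes "fst ` set ps \<inter> snd ` set ps = {}"
    and "\<And>x. x \<in> snd ` set ps \<Longrightarrow> e x \<in> univ M"
    and "\<And>u x. (u, x) \<in> set ps \<Longrightarrow> e' u = e x"
    and "\<And>v. v \<in> fv p \<Longrightarrow> v \<notin> fst ` set ps \<Longrightarrow> e' v = e v"
  shows "sat M e (identify ps p) \<longleftrightarrow> sat M e' p"
  using assms
proof (induction ps p arbitrary: e rule: identify.induct)
  case (1 p)
  then show ?case by (auto intro!: sat_cong)
next
  case (2 u x ps p)
  have ne: "u \<notin> snd ` set ps" "u \<noteq> x" using 2(2) by auto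
  have "sat M e (identify ((u, x) # ps) p) \<longleftrightarrow> sat M (e(u := e x)) (identify ps p)"
    using ne 2(3)[of x] by auto
  also have "\<dots> \<longleftrightarrow> sat M e' p"
  proof (rule "2.IH")
    show "fst ` set ps \<inter> snd ` set ps = {}" using 2(2) by auto
    show "(e(u := e x)) z \<in> univ M" if "z \<in> snd ` set ps" for z
      using that ne 2(3) by auto
    show "e' w = (e(u := e x)) z" if "(w, z) \<in> set ps" for w z
    proof -
      have "z \<noteq> u" using that ne by force
      then show ?thesis using that 2(4)[of w z] by simp
    qed
    show "e' v = (e(u := e x)) v" if "v \<in> fv p" "v \<notin> fst ` set ps" for v
      using that 2(4)[of u x] 2(5)[of v] by auto
  qed
  finally show ?case .
qed

text \<open>Lets two \<open>holds\<close> statements with different partitions be compared under a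
  single valuation.\<close>

lemma holds_iff_sat:
  assumes "distinct (xs @ ys)" "fv p \<subseteq> set xs \<union> set ys" "map e xs = a" "map e ys = b"
  shows "holds M xs ys p a b \<longleftrightarrow> sat M e p"
proof -
  have "map_of (zip (xs @ ys) (map e (xs @ ys))) v = Some (e v)" if "v \<in> set (xs @ ys)" for v
    using that by (simp only: map_of_zip_map if_True)
  moreover have "map e (xs @ ys) = a @ b" using assms by simp
  ultimately have "the (map_of (zip (xs @ ys) (a @ b)) v) = e v" if "v \<in> fv p" for v
    using that assms(2) by (metis UnCI option.sel set_append subsetD)
  then show ?thesis unfolding holds_def by (rule sat_cong)
qed

lemma obtain_valuation:
  assumes "distinct vs" "length vs = length as"
  obtains e where "map e vs = as"
proof
  show "map (\<lambda>v. the (map_of (zip vs as) v)) vs = as"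
    using assms by (intro nth_equalityI) (auto simp: map_of_zip_nth)
qed

section \<open>Counting types\<close>

lemma infinite_tuples:
  assumes "infinite (univ M)" "n > 0"
  shows "infinite (tuples M n)"
proof
  assume "finite (tuples M n)"
  moreover have "replicate n ` univ M \<subseteq> tuples M n" by (auto simp: tuples_def)
  ultimately have "finite (replicate n ` univ M)" by (rule finite_subset[rotated])
  moreover have "inj_on (replicate n) (univ M)"
    using assms(2) by (auto simp: inj_on_def replicate_eq_replicate)
  ultimately show False using assms(1) finite_imageD by blast
qed

text \<open>A type is a subset of the positive and negative instances over \<open>B\<close>. The
  crude bound depends on \<open>B\<close> only through its size, which makes the maximum in
  \<open>pi_star\<close> one over a finite set.\<close>

lemma finite_card_types:
  assumes "finite \<Delta>" "finite B"
  shows "finite (types M xs ys \<Delta> B)"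
    and "card (types M xs ys \<Delta> B) \<le> 2 ^ (2 * (card \<Delta> * card B))"
proof -
  let ?P = "case_prod Pos ` (\<Delta> \<times> B)" and ?N = "case_prod NegInst ` (\<Delta> \<times> B)"
  have sub: "types M xs ys \<Delta> B \<subseteq> Pow (?P \<union> ?N)"
    by (auto simp: types_def tp_def)
  have fin: "finite (?P \<union> ?N)" using assms by simp
  then show "finite (types M xs ys \<Delta> B)" using sub finite_subset by blast
  have "card (?P \<union> ?N) \<le> card ?P + card ?N" by (rule card_Un_le)
  also have "\<dots> \<le> card (\<Delta> \<times> B) + card (\<Delta> \<times> B)"
    using assms by (intro add_mono card_image_le) auto
  finally have le: "card (?P \<union> ?N) \<le> 2 * (card \<Delta> * card B)"
    by (simp add: card_cartesian_product)
  have "card (types M xs ys \<Delta> B) \<le> card (Pow (?P \<union> ?N))"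
    using sub fin by (intro card_mono) auto
  also have "\<dots> = 2 ^ card (?P \<union> ?N)" using fin by (rule card_Pow)
  also have "\<dots> \<le> 2 ^ (2 * (card \<Delta> * card B))"
    using le by (intro power_increasing) auto
  finally show "card (types M xs ys \<Delta> B) \<le> 2 ^ (2 * (card \<Delta> * card B))" .
qed

lemma finite_pi_star_set:
  assumes "finite \<Delta>"
  shows "finite {card (types M xs ys \<Delta> B) | B. B \<subseteq> tuples M (length ys) \<and> finite B \<and> card B = t}"
proof (rule finite_subset)
  show "{card (types M xs ys \<Delta> B) | B. B \<subseteq> tuples M (length ys) \<and> finite B \<and> card B = t}
    \<subseteq> {..2 ^ (2 * (card \<Delta> * t))}"
    using finite_card_types(2)[OF assms] by fastforce
qed simp

lemma card_types_le_pi_star: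
  assumes "finite \<Delta>" "B \<subseteq> tuples M (length ys)" "finite B"
  shows "card (types M xs ys \<Delta> B) \<le> pi_star M xs ys \<Delta> (card B)"
  unfolding pi_star_def using assms
  by (intro Max_ge finite_pi_star_set) auto

text \<open>\<open>Max\<close> of the empty set is unspecified, so some \<open>B\<close> of size
  \<open>t\<close> must exist; an infinite universe and a nonempty \<open>ys\<close> provide
  one.\<close>

lemma pi_star_le:
  assumes "finite \<Delta>" "infinite (univ M)" "ys \<noteq> []"
    and "\<And>B. B \<subseteq> tuples M (length ys) \<Longrightarrow> finite B \<Longrightarrow> card B = t \<Longrightarrow>
           card (types M xs ys \<Delta> B) \<le> c"
  shows "pi_star M xs ys \<Delta> t \<le> c"
proof -
  have "infinite (tuples M (length ys))" using assms(2,3) by (intro infinite_tuples) auto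
  then obtain B where "finite B" "card B = t" "B \<subseteq> tuples M (length ys)"
    using infinite_arbitrarily_large by blast
  then have "{card (types M xs ys \<Delta> B) | B. B \<subseteq> tuples M (length ys) \<and> finite B \<and> card B = t} \<noteq> {}"
    by blast
  then show ?thesis
    unfolding pi_star_def using assms(4) finite_pi_star_set[OF assms(1)]
    by (subst Max_le_iff) auto
qed

section \<open>Eliminating one variable\<close>

text \<open>In the notation above, \<open>zs\<close> lists the tuples \<open>(x'\<^sub>j, y\<^sub>j)\<close> and each \<open>x'\<^sub>j\<close> is identified with \<open>x'\<close>.\<close>

definition diagonal_formula ::
  "nat list \<Rightarrow> nat list list \<Rightarrow> ('f, 'r) fm \<Rightarrow> ('f, 'r) fm" where
  "diagonal_formula xs zs p = identify (concat (map (\<lambda>z. zip (take (length xs) z) xs) zs)) p"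

text \<open>These are the blocks \<open>y\<^sub>1, \<dots>, y\<^sub>d\<close>, which stay free after
  the identification and join \<open>y\<close> as parameter variables.\<close>

definition residual_vars :: "nat list \<Rightarrow> nat list list \<Rightarrow> nat list" where
  "residual_vars xs zs = concat (map (drop (length xs)) zs)"

lemma set_residual_vars: "set (residual_vars xs zs) \<subseteq> set (concat zs)"
  by (auto simp: residual_vars_def dest: in_set_dropD)

lemma distinct_residual_vars:
  "distinct (concat zs) \<Longrightarrow> distinct (residual_vars xs zs)"
proof (induction zs)
  case (Cons z zs)
  have "set (drop (length xs) z) \<subseteq> set z" by (rule set_drop_subset)
  then show ?case
    using Cons set_residual_vars[of xs zs] by (auto simp: residual_vars_def)
qed (simp add: residual_vars_def)

text \<open>Each variable of \<open>zs\<close> lies either in an initial block, which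
  \<open>identify\<close> binds, or in a residual block; the only variables that
  \<open>identify\<close> can add come from \<open>xs\<close>.\<close>

lemma partitioned_diagonal_formula:
  assumes part: "partitioned L (xs @ ys) (concat zs) p"
    and len: "\<forall>z\<in>set zs. length z = length xs + length ys"
  shows "partitioned L xs (ys @ residual_vars xs zs) (diagonal_formula xs zs p)"
proof -
  let ?ps = "concat (map (\<lambda>z. zip (take (length xs) z) xs) zs)"
  have dist: "distinct ((xs @ ys) @ concat zs)" and fv: "fv p \<subseteq> set (xs @ ys) \<union> set (concat zs)"
    using part by (auto simp: partitioned_def)
  have fst: "fst ` set ?ps = (\<Union>z\<in>set zs. set (take (length xs) z))"
  proof -
    have "fst ` set (zip (take (length xs) z) xs) = set (take (length xs) z)" if "z \<in> set zs" for z
      using that len by (simp flip: set_map)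
    then show ?thesis by (simp add: image_UN)
  qed
  have snd: "snd ` set ?ps \<subseteq> set xs" by (auto dest: set_zip_rightD)
  have "v \<in> fst ` set ?ps \<union> set (residual_vars xs zs)" if v: "v \<in> set (concat zs)" for v
  proof -
    obtain z where z: "z \<in> set zs" "v \<in> set z" using v by auto
    then have "v \<in> set (take (length xs) z) \<or> v \<in> set (drop (length xs) z)"
      by (metis UnE append_take_drop_id set_append)
    then show ?thesis using z(1) by (subst fst) (auto simp: residual_vars_def)
  qed
  then have "fv (diagonal_formula xs zs p) \<subseteq> set xs \<union> set (ys @ residual_vars xs zs)"
    using fv_identify[of ?ps p] fv snd unfolding diagonal_formula_def set_append by blast
  moreover have "distinct (xs @ ys @ residual_vars xs zs)"
    using dist distinct_residual_vars[of zs xs] set_residual_vars[of xs zs] by auto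
  ultimately show ?thesis
    using part by (auto simp: partitioned_def diagonal_formula_def)
qed

text \<open>One valuation \<open>e'\<close> sends \<open>xs\<close> to \<open>a\<close>,
  \<open>ys\<close> to \<open>b\<close> and each \<open>z\<^sub>j\<close> to
  \<open>a @ b\<^sub>j\<close>. It already gives identified variables equal values, so
  \<open>identify\<close> does not affect truth under it.\<close>

lemma holds_diagonal_formula:
  assumes part: "partitioned L (xs @ ys) (concat zs) p"
    and len: "\<forall>z\<in>set zs. length z = length xs + length ys"
    and a: "a \<in> tuples M (length xs)" and b: "length b = length ys"
    and bs: "length bs = length zs" "\<forall>c\<in>set bs. length c = length ys"
  shows "holds M xs (ys @ residual_vars xs zs) (diagonal_formula xs zs p) a (b @ concat bs) \<longleftrightarrow>
         holds M (xs @ ys) (concat zs) p (a @ b) (concat (map ((@) a) bs))"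
proof -
  let ?ps = "concat (map (\<lambda>z. zip (take (length xs) z) xs) zs)"
  have dist: "distinct ((xs @ ys) @ concat zs)" and fv: "fv p \<subseteq> set (xs @ ys) \<union> set (concat zs)"
    using part by (auto simp: partitioned_def)
  have la: "length a = length xs" using a by (simp add: tuples_def)
  have lens: "list_all2 (\<lambda>z c. length z = length c) zs (map ((@) a) bs)"
    using bs len la by (auto simp: list_all2_conv_all_nth)
  have "length (concat zs) = length (concat (map ((@) a) bs))"
    using lens by (induction rule: list_all2_induct) auto
  then have "length ((xs @ ys) @ concat zs) = length ((a @ b) @ concat (map ((@) a) bs))"
    using la b by simp
  then obtain e' where e': "map e' ((xs @ ys) @ concat zs) = (a @ b) @ concat (map ((@) a) bs)"
    using obtain_valuation[OF dist] by blast
  then have e'x: "map e' xs = a" and e'y: "map e' ys = b"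
    and e'z: "concat (map (map e') zs) = concat (map ((@) a) bs)"
    using la b by (auto simp: map_concat)
  \<comment> \<open>Corresponding blocks have equal lengths, so the equality of concatenations
    splits blockwise.\<close>
  have "map (map e') zs = map ((@) a) bs"
    using e'z bs len la by (subst (asm) concat_eq_concat_iff) (auto simp: set_zip)
  then have e'nth: "map e' (zs ! k) = a @ bs ! k" if "k < length zs" for k
    using that bs by (metis nth_map)
  have take: "map e' (take (length xs) z) = a" if "z \<in> set zs" for z
    using that e'nth la by (auto simp: in_set_conv_nth simp flip: take_map)
  have "map (map e') (map (drop (length xs)) zs) = bs"
    using e'nth la bs by (intro nth_equalityI) (auto simp flip: drop_map)
  then have drop: "map e' (residual_vars xs zs) = concat bs"
    by (simp add: residual_vars_def map_concat)
  have fst: "fst ` set ?ps \<subseteq> set (concat zs)"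
    by (auto dest!: set_zip_leftD in_set_takeD)
  have snd: "snd ` set ?ps \<subseteq> set xs" by (auto dest: set_zip_rightD)
  have "holds M xs (ys @ residual_vars xs zs) (diagonal_formula xs zs p) a (b @ concat bs) \<longleftrightarrow>
        sat M e' (diagonal_formula xs zs p)"
    using partitioned_diagonal_formula[OF part len] e'x e'y drop
    by (intro holds_iff_sat) (auto simp: partitioned_def)
  also have "\<dots> \<longleftrightarrow> sat M e' p"
    unfolding diagonal_formula_def
  proof (rule sat_identify)
    show "fst ` set ?ps \<inter> snd ` set ?ps = {}"
    proof -
      have "set xs \<inter> set (concat zs) = {}" using dist by auto
      then show ?thesis using fst snd by blast
    qed
    show "e' x \<in> univ M" if "x \<in> snd ` set ?ps" for x
    proof -
      have "e' x \<in> set (map e' xs)" using that snd by auto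
      then show ?thesis using e'x a by (auto simp: tuples_def)
    qed
    show "e' u = e' x" if ux: "(u, x) \<in> set ?ps" for u x
    proof -
      obtain z where z: "z \<in> set zs" and "(u, x) \<in> set (zip (take (length xs) z) xs)"
        using ux by auto
      then obtain k where k: "k < length xs" "k < length z"
        "u = take (length xs) z ! k" "x = xs ! k"
        unfolding set_zip by auto
      have "e' u = map e' (take (length xs) z) ! k" using k by simp
      also have "\<dots> = map e' xs ! k" using take[OF z] e'x by simp
      finally show ?thesis using k by simp
    qed
  qed simp
  also have "\<dots> \<longleftrightarrow> holds M (xs @ ys) (concat zs) p (a @ b) (concat (map ((@) a) bs))"
    using dist fv e'x e'y e'z
    by (intro holds_iff_sat[symmetric]) (auto simp: map_concat)
  finally show ?thesis .
qed

section \<open>Bounding the number of types by types in one variable less\<close>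

lemma length_residual_vars:
  assumes "\<forall>z\<in>set zs. length z = length xs + n"
  shows "length (residual_vars xs zs) = n * length zs"
  using assms by (induction zs) (auto simp: residual_vars_def)

lemma concat_in_tuples:
  assumes "set bs \<subseteq> tuples M n"
  shows "concat bs \<in> tuples M (n * length bs)"
  using assms by (induction bs) (auto simp: tuples_def)

lemma card_types_Cons_le:
  assumes ps: "partitioned_set L (x # xs) ys \<Delta>"
    and ud: "uniform_definition L M [x] (xs @ ys) \<Delta> d zs I F"
    and B: "B \<subseteq> tuples M (length ys)" "finite B" "B \<noteq> {}"
  shows "card (types M (x # xs) ys \<Delta> B) \<le>
    (\<Sum>i\<in>I. card B ^ d *
       pi_star M xs (ys @ residual_vars xs zs) ((\<lambda>p. diagonal_formula xs zs (F i p)) ` \<Delta>) (card B))"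
proof -
  let ?ws = "ys @ residual_vars xs zs"
  let ?\<Psi> = "\<lambda>i. (\<lambda>p. diagonal_formula xs zs (F i p)) ` \<Delta>"
  \<comment> \<open>The chosen parameters are appended to every point of \<open>B\<close>, so the
    residual type lives over a set of the same size as \<open>B\<close>.\<close>
  let ?C = "\<lambda>bs. (\<lambda>b. b @ concat bs) ` B"
  let ?Bd = "{bs. set bs \<subseteq> B \<and> length bs = d}"
  \<comment> \<open>Decodes a residual type into a type over \<open>B\<close>. It ranges over
    \<open>p\<close> itself, since different \<open>p\<close> may have the same diagonal
    formula.\<close>
  let ?G = "\<lambda>(i, bs) q.
    {Pos p b | p b. p \<in> \<Delta> \<and> b \<in> B \<and> Pos (diagonal_formula xs zs (F i p)) (b @ concat bs) \<in> q} \<union>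
    {NegInst p b | p b. p \<in> \<Delta> \<and> b \<in> B \<and> Pos (diagonal_formula xs zs (F i p)) (b @ concat bs) \<notin> q}"
  let ?T = "\<lambda>(i, bs). types M xs ?ws (?\<Psi> i) (?C bs)"
  have fin\<Delta>: "finite \<Delta>" using ps by (simp add: partitioned_set_def)
  have finI: "finite I" and lzs: "length zs = d"
    and len: "\<forall>z\<in>set zs. length z = length xs + length ys"
    and part: "\<And>i p. i \<in> I \<Longrightarrow> p \<in> \<Delta> \<Longrightarrow> partitioned L (xs @ ys) (concat zs) (F i p)"
    using ud by (auto simp: uniform_definition_def)
  have finBd: "finite ?Bd" using B(2) by (rule finite_lists_length_eq)
  have finT: "finite (?T k)" if "k \<in> I \<times> ?Bd" for k
    using fin\<Delta> B(2) by (auto split: prod.split intro!: finite_card_types(1))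
  have sub: "types M (x # xs) ys \<Delta> B \<subseteq> (\<Union>k\<in>I \<times> ?Bd. ?G k ` ?T k)"
  proof
    fix q assume "q \<in> types M (x # xs) ys \<Delta> B"
    then obtain a0 a where a: "a0 \<in> univ M" "a \<in> tuples M (length xs)"
      and q: "q = tp M (x # xs) ys \<Delta> (a0 # a) B"
      by (auto simp: types_def tuples_def length_Suc_conv)
    let ?D = "(@) a ` B"
    have D: "finite ?D" "?D \<noteq> {}" using B by auto
    have "a @ b \<in> tuples M (length (xs @ ys))" if "b \<in> B" for b
      using that a(2) subsetD[OF B(1) that] by (simp add: tuples_def)
    then have D': "?D \<subseteq> tuples M (length (xs @ ys))" by blast
    have "tp M [x] (xs @ ys) \<Delta> [a0] ?D \<in> types M [x] (xs @ ys) \<Delta> ?D"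
      using a by (auto simp: types_def tuples_def)
    then obtain cs i where cs: "length cs = d" "set cs \<subseteq> ?D" and i: "i \<in> I"
      and defi: "\<forall>p\<in>\<Delta>. \<forall>c\<in>?D. Pos p c \<in> tp M [x] (xs @ ys) \<Delta> [a0] ?D \<longleftrightarrow>
        holds M (xs @ ys) (concat zs) (F i p) c (concat cs)"
      using ud D D' unfolding uniform_definition_def by meson
    \<comment> \<open>All defining parameters come from \<open>?D\<close>, hence share the initial
      part \<open>a\<close>; this is what justifies identifying every \<open>x'\<^sub>j\<close> with
      \<open>x'\<close>.\<close>
    have "cs \<in> lists ((@) a ` B)" using cs by auto
    then obtain bs where bs: "cs = map ((@) a) bs" "set bs \<subseteq> B"
      by (auto simp: lists_image)
    have key: "holds M (x # xs) ys p (a0 # a) b \<longleftrightarrow>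
        holds M xs ?ws (diagonal_formula xs zs (F i p)) a (b @ concat bs)"
      if p: "p \<in> \<Delta>" and b: "b \<in> B" for p b
    proof -
      \<comment> \<open>Moving \<open>xs\<close> to the parameter side leaves the concatenated lists
        of variables and values unchanged.\<close>
      have "holds M (x # xs) ys p (a0 # a) b \<longleftrightarrow> holds M [x] (xs @ ys) p [a0] (a @ b)"
        by (simp add: holds_def)
      also have "\<dots> \<longleftrightarrow> Pos p (a @ b) \<in> tp M [x] (xs @ ys) \<Delta> [a0] ?D"
        using p b by (auto simp: tp_def)
      also have "\<dots> \<longleftrightarrow> holds M (xs @ ys) (concat zs) (F i p) (a @ b) (concat (map ((@) a) bs))"
        using defi p b bs by blast
      also have "\<dots> \<longleftrightarrow> holds M xs ?ws (diagonal_formula xs zs (F i p)) a (b @ concat bs)"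
        using part[OF i p] len a(2) b bs cs lzs B(1)
        by (intro holds_diagonal_formula[symmetric]) (auto simp: tuples_def)
      finally show ?thesis .
    qed
    let ?q = "tp M xs ?ws (?\<Psi> i) a (?C bs)"
    have mem: "Pos (diagonal_formula xs zs (F i p)) (b @ concat bs) \<in> ?q \<longleftrightarrow>
        holds M (x # xs) ys p (a0 # a) b" if "p \<in> \<Delta>" "b \<in> B" for p b
      using that key[OF that] by (auto simp: tp_def)
    have "q = ?G (i, bs) ?q"
      unfolding q using mem by (simp add: tp_def[of M "x # xs"] cong: conj_cong)
    moreover have "?q \<in> ?T (i, bs)" using a by (auto simp: types_def)
    moreover have "(i, bs) \<in> I \<times> ?Bd" using i bs cs by auto
    ultimately show "q \<in> (\<Union>k\<in>I \<times> ?Bd. ?G k ` ?T k)" by blast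
  qed
  have bound: "card (?T (i, bs)) \<le> pi_star M xs ?ws (?\<Psi> i) (card B)" if "bs \<in> ?Bd" for i bs
  proof -
    have "concat bs \<in> tuples M (length (residual_vars xs zs))"
      using that B(1) concat_in_tuples[of bs M "length ys"] length_residual_vars[OF len] lzs
      by auto
    then have "b @ concat bs \<in> tuples M (length ?ws)" if "b \<in> B" for b
      using subsetD[OF B(1) that] by (simp add: tuples_def)
    then have "?C bs \<subseteq> tuples M (length ?ws)" by blast
    moreover have "card (?C bs) = card B" by (intro card_image) (auto simp: inj_on_def)
    ultimately show ?thesis
      using card_types_le_pi_star[of "?\<Psi> i" "?C bs" M ?ws xs] fin\<Delta> B(2) by simp
  qed
  \<comment> \<open>Union bound over the pairs \<open>(i, bs)\<close>; the factor
    \<open>card B ^ d\<close> is the number of lists \<open>bs\<close>.\<close>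
  have "card (types M (x # xs) ys \<Delta> B) \<le> card (\<Union>k\<in>I \<times> ?Bd. ?G k ` ?T k)"
    using sub finI finBd finT by (intro card_mono finite_UN_I finite_cartesian_product finite_imageI)
  also have "\<dots> \<le> (\<Sum>k\<in>I \<times> ?Bd. card (?G k ` ?T k))"
    using finI finBd by (intro card_UN_le finite_cartesian_product)
  also have "\<dots> \<le> (\<Sum>k\<in>I \<times> ?Bd. card (?T k))"
    using finT by (intro sum_mono card_image_le)
  also have "\<dots> = (\<Sum>i\<in>I. \<Sum>bs\<in>?Bd. card (?T (i, bs)))"
    by (simp add: sum.cartesian_product case_prod_unfold)
  also have "\<dots> \<le> (\<Sum>i\<in>I. \<Sum>bs\<in>?Bd. pi_star M xs ?ws (?\<Psi> i) (card B))"
    using bound by (intro sum_mono)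
  also have "\<dots> = (\<Sum>i\<in>I. card B ^ d * pi_star M xs ?ws (?\<Psi> i) (card B))"
    using B(2) by (simp add: card_lists_length_eq)
  finally show ?thesis .
qed

section \<open>Induction on the length of the object tuple\<close>

theorem theorem7p1:
  fixes L :: "('f, 'r) language" and M :: "('f, 'r, 'm) struct" and d :: nat and r :: real
  assumes "is_structure L M"
    and "infinite (univ M)"
    and "strong_VC L M d"
    and "\<And>xs ys \<Delta>. partitioned_set L xs ys \<Delta> \<Longrightarrow> length xs = 1 \<Longrightarrow>
           (\<lambda>t::nat. real (pi_star M xs ys \<Delta> t)) \<in> O(\<lambda>t. real t powr r)"
  shows "\<And>xs ys \<Delta>. partitioned_set L xs ys \<Delta> \<Longrightarrow>
           (\<lambda>t::nat. real (pi_star M xs ys \<Delta> t))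
             \<in> O(\<lambda>t. real t powr (real d * (real (length xs) - 1) + r))"
proof -
  fix xs ys :: "nat list" and \<Delta> :: "('f, 'r) fm set"
  assume "partitioned_set L xs ys \<Delta>"
  then show "(\<lambda>t::nat. real (pi_star M xs ys \<Delta> t))
      \<in> O(\<lambda>t. real t powr (real d * (real (length xs) - 1) + r))"
  \<comment> \<open>Eliminating a variable changes both the parameter variables and the formulas, so
    both are generalized. The real base case is a single variable, where the exponent is
    \<open>r\<close>.\<close>
  proof (induction xs arbitrary: ys \<Delta>)
    case Nil
    then show ?case by (simp add: partitioned_set_def)
  next
    case (Cons x xs)
    show ?case
    proof (cases "xs = []")
      case True
      then show ?thesis using assms(4)[OF Cons.prems] by simp
    next
      case False
      have ps: "ys \<noteq> []" "finite \<Delta>" "\<Delta> \<noteq> {}" "\<And>p. p \<in> \<Delta> \<Longrightarrow> partitioned L (x # xs) ys p"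
        using Cons.prems by (auto simp: partitioned_set_def)
      have "partitioned_set L [x] (xs @ ys) \<Delta>"
        using ps False by (auto simp: partitioned_set_def partitioned_def)
      then obtain zs I F where ud: "uniform_definition L M [x] (xs @ ys) \<Delta> d zs I F"
        using assms(3) unfolding strong_VC_def by (metis One_nat_def length_Cons list.size(3))
      let ?f = "\<lambda>i. pi_star M xs (ys @ residual_vars xs zs)
        ((\<lambda>p. diagonal_formula xs zs (F i p)) ` \<Delta>)"
      let ?s = "real d * (real (length xs) - 1) + r"
      have "partitioned_set L xs (ys @ residual_vars xs zs)
          ((\<lambda>p. diagonal_formula xs zs (F i p)) ` \<Delta>)" if "i \<in> I" for i
        using that ud ps False unfolding partitioned_set_def uniform_definition_def
        by (auto intro!: partitioned_diagonal_formula)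
      \<comment> \<open>The index set \<open>I\<close> is finite and independent of
        \<open>t\<close>, so the bounds for the single \<open>i\<close> add up to one of the same
        order.\<close>
      then have "(\<lambda>t. real (?f i t)) \<in> O(\<lambda>t. real t powr ?s)" if "i \<in> I" for i
        using that Cons.IH by blast
      then have "(\<lambda>t. \<Sum>i\<in>I. real t ^ d * real (?f i t)) \<in> O(\<lambda>t. real t ^ d * real t powr ?s)"
        by (intro big_sum_in_bigo landau_o.big.mult) auto
      moreover have "(\<lambda>t. real (pi_star M (x # xs) ys \<Delta> t))
          \<in> O(\<lambda>t. \<Sum>i\<in>I. real t ^ d * real (?f i t))"
      \<comment> \<open>Positive \<open>t\<close> makes \<open>B\<close> nonempty, as the uniform
        definition requires.\<close>
      proof (intro landau_o.big_mono eventually_mono[OF eventually_gt_at_top[of 0]])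
        fix t :: nat assume t: "0 < t"
        have "pi_star M (x # xs) ys \<Delta> t \<le> (\<Sum>i\<in>I. t ^ d * ?f i t)"
        proof (rule pi_star_le[OF ps(2) assms(2) ps(1)])
          fix B assume B: "B \<subseteq> tuples M (length ys)" "finite B" "card B = t"
          then have "B \<noteq> {}" using t by auto
          then show "card (types M (x # xs) ys \<Delta> B) \<le> (\<Sum>i\<in>I. t ^ d * ?f i t)"
            using card_types_Cons_le[OF Cons.prems ud B(1,2)] B(3) by simp
        qed
        then have "real (pi_star M (x # xs) ys \<Delta> t) \<le> (\<Sum>i\<in>I. real t ^ d * real (?f i t))"
          by (auto dest: of_nat_mono[where ?'a = real])
        then show "norm (real (pi_star M (x # xs) ys \<Delta> t))
            \<le> norm (\<Sum>i\<in>I. real t ^ d * real (?f i t))" by simp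
      qed
      moreover have "(\<lambda>t. real t ^ d * real t powr ?s)
          \<in> O(\<lambda>t. real t powr (real d * (real (length (x # xs)) - 1) + r))"
      \<comment> \<open>Positive \<open>t\<close> turns \<open>real t ^ d\<close> into
        \<open>real t powr real d\<close>; the extra variable thus raises the exponent by exactly
        \<open>d\<close>.\<close>
      proof (intro landau_o.big_mono eventually_mono[OF eventually_gt_at_top[of 0]])
        fix t :: nat assume t: "0 < t"
        have "real t ^ d * real t powr ?s = real t powr (real d + ?s)"
          using t by (simp add: powr_add powr_realpow)
        also have "real d + ?s = real d * (real (length (x # xs)) - 1) + r"
          by (simp add: algebra_simps)
        finally show "norm (real t ^ d * real t powr ?s)
            \<le> norm (real t powr (real d * (real (length (x # xs)) - 1) + r))" by simp
      qed
      ultimately show ?thesis by (meson landau_o.big_trans)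
    qed
  qed
qed

end
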